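(* Let $p,q\geq 2$ be integers. Then the degree of a $p\times q$ rectangular band is equal to \[ \beta(p,q)=\min_{r\geq 2}\beta_r(p,q),\qquad\text{where}\qquad \beta_r(p,q)=\min\bigl\{\,n\in\mathbb N : \pi_r\bigl(n-\lceil\log_r p\rceil\bigr)\geq q\,\bigr\}\ \text{ for } r\geq 2 . \]
   Context: For $n\in\mathbb N$, $\mathcal T_n$ denotes the full transformation semigroup of all maps $\{1,\dots,n\}\to\{1,\dots,n\}$ under composition. The degree $\mu(S)$ of a finite semigroup $S$ is the least $n\geq 1$ such that $S$ embeds (as a subsemigroup, up to isomorphism) in $\mathcal T_n$. A $p\times q$ rectangular band is a semigroup $P\times Q$ with $|P|=p$, $|Q|=q$ and multiplication $(p_1,q_1)(p_2,q_2)=(p_1,q_2)$. A composition of $m\in\mathbb N$ of length $r$ is a tuple $(s_1,\dots,s_r)$ of positive integers with $s_1+\cdots+s_r=m$; for $1\leq r\leq m$, $\pi_r(m)$ is the maximum of the products $s_1\cdots s_r$ over all compositions $(s_1,\dots,s_r)$ of $m$ of length $r$ (the condition $\pi_r(m)\geq q$ is understood to fail when $m<r$, as there are then no such compositions). *)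

theory Defs
  imports Complex_Main "HOL-Library.FuncSet"
begin

definition semigroup_embedding ::
  "'a set \<Rightarrow> ('a \<Rightarrow> 'a \<Rightarrow> 'a) \<Rightarrow> 'b set \<Rightarrow> ('b \<Rightarrow> 'b \<Rightarrow> 'b) \<Rightarrow> ('a \<Rightarrow> 'b) \<Rightarrow> bool" where
  "semigroup_embedding S f T g h \<longleftrightarrow>
     h \<in> S \<rightarrow> T \<and> inj_on h S \<and> (\<forall>x\<in>S. \<forall>y\<in>S. h (f x y) = g (h x) (h y))"

definition full_trans :: "nat \<Rightarrow> (nat \<Rightarrow> nat) set" where
  "full_trans n = {1..n} \<rightarrow>\<^sub>E {1..n}"

text \<open>Transformations act on the right and are composed from left to right: the product
  of \<open>f\<close> and \<open>g\<close> maps \<open>x\<close> to \<open>g (f x)\<close>. The order matters: composing from right to left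
  replaces each semigroup by its dual, hence swaps the two parameters of a rectangular
  band, and the degree of a rectangular band is not symmetric in these.\<close>

definition trans_mult :: "nat \<Rightarrow> (nat \<Rightarrow> nat) \<Rightarrow> (nat \<Rightarrow> nat) \<Rightarrow> (nat \<Rightarrow> nat)" where
  "trans_mult n f g = compose {1..n} g f"

definition semigroup_degree :: "'a set \<Rightarrow> ('a \<Rightarrow> 'a \<Rightarrow> 'a) \<Rightarrow> nat" where
  "semigroup_degree S f =
     (LEAST n. 1 \<le> n \<and> (\<exists>h. semigroup_embedding S f (full_trans n) (trans_mult n) h))"

definition rect_mult :: "'a \<times> 'b \<Rightarrow> 'a \<times> 'b \<Rightarrow> 'a \<times> 'b" where
  "rect_mult x y = (fst x, snd y)"

definition compositions :: "nat \<Rightarrow> nat \<Rightarrow> nat list set" where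
  "compositions r m = {s. length s = r \<and> (\<forall>x\<in>set s. 1 \<le> x) \<and> sum_list s = m}"

text \<open>Only meaningful for \<open>1 \<le> r \<le> m\<close>, when the set of compositions is finite and nonempty.\<close>

definition max_comp_prod :: "nat \<Rightarrow> nat \<Rightarrow> nat" where
  "max_comp_prod r m = Max (prod_list ` compositions r m)"

text \<open>The first conjunct makes the condition fail when no composition of length \<open>r\<close> exists.\<close>

definition beta_r :: "nat \<Rightarrow> nat \<Rightarrow> nat \<Rightarrow> nat" where
  "beta_r r p q =
     (LEAST n. int r \<le> int n - \<lceil>log (real r) (real p)\<rceil> \<and>
               q \<le> max_comp_prod r (nat (int n - \<lceil>log (real r) (real p)\<rceil>)))"

definition beta :: "nat \<Rightarrow> nat \<Rightarrow> nat" where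
  "beta p q = (LEAST b. \<exists>r\<ge>2. b = beta_r r p q)"

end

theory Submission imports Defs begin

text \<open>In a rectangular band of transformations \<open>e\<^sub>i\<^sub>j\<close>, the kernel depends only on \<open>i\<close> and the
  image only on \<open>j\<close>, and the two determine \<open>e\<^sub>i\<^sub>j\<close>. Let \<open>X\<close> be the union of all images and
  \<open>r\<close> the common rank. On \<open>X\<close> all kernels agree, with classes of sizes \<open>s\<^sub>1, \<dots>, s\<^sub>r\<close> say; every
  image is a transversal of these classes, so \<open>q \<le> s\<^sub>1 \<cdots> s\<^sub>r\<close>. A kernel is then determined by
  the classes to which the \<open>c\<close> points outside \<open>X\<close> are attached, so \<open>p \<le> r ^ c\<close>. Conversely, the
  attachments and the transversals for any such data form an \<open>r ^ c \<times> (s\<^sub>1 \<cdots> s\<^sub>r)\<close> rectangular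
  band of transformations of \<open>s\<^sub>1 + \<cdots> + s\<^sub>r + c\<close> points.\<close>


subsection \<open>Compositions\<close>

lemma compositions_length_le:
  assumes "s \<in> compositions r m"
  shows "r \<le> m"
proof -
  have "length s \<le> sum_list s" if "\<forall>x\<in>set s. 1 \<le> x" for s :: "nat list"
    using that by (induction s) auto
  with assms show ?thesis by (auto simp: compositions_def)
qed

lemma finite_compositions: "finite (compositions r m)"
proof (rule finite_subset)
  show "compositions r m \<subseteq> {s. set s \<subseteq> {..m} \<and> length s = r}"
    by (auto simp: compositions_def member_le_sum_list)
  show "finite {s::nat list. set s \<subseteq> {..m} \<and> length s = r}"
    by (rule finite_lists_length_eq) simp
qed

lemma Cons_replicate_1_in_compositions:
  assumes "1 \<le> k"
  shows "k # replicate r 1 \<in> compositions (Suc r) (k + r)"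
  using assms by (auto simp: compositions_def sum_list_replicate)

lemma compositions_eq_empty_iff:
  assumes "1 \<le> r"
  shows "compositions r m = {} \<longleftrightarrow> m < r"
proof
  have "compositions r m \<noteq> {}" if "r \<le> m"
    using Cons_replicate_1_in_compositions[of "m - (r - 1)" "r - 1"] assms that by force
  then show "m < r" if "compositions r m = {}"
    using that by linarith
qed (use compositions_length_le in fastforce)

lemma compositions_prod_list_mono:
  assumes "s \<in> compositions r k" "1 \<le> r" "k \<le> m"
  obtains t where "t \<in> compositions r m" "prod_list s \<le> prod_list t"
proof -
  obtain x xs where s: "s = x # xs"
    using assms by (cases s) (auto simp: compositions_def)
  show thesis
  proof
    show "(x + (m - k)) # xs \<in> compositions r m"
      using assms s by (auto simp: compositions_def)
    show "prod_list s \<le> prod_list ((x + (m - k)) # xs)"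
      by (simp add: s)
  qed
qed

lemma le_max_comp_prod_iff:
  assumes "1 \<le> r"
  shows "r \<le> m \<and> q \<le> max_comp_prod r m \<longleftrightarrow> (\<exists>s\<in>compositions r m. q \<le> prod_list s)"
proof (cases "r \<le> m")
  case True
  then have "compositions r m \<noteq> {}"
    using assms by (simp add: compositions_eq_empty_iff)
  with True show ?thesis
    by (simp add: max_comp_prod_def Max_ge_iff finite_compositions)
next
  case False
  then show ?thesis
    using compositions_length_le by blast
qed


subsection \<open>Feasible ranks\<close>

definition rank_feasible :: "nat \<Rightarrow> nat \<Rightarrow> nat \<Rightarrow> nat \<Rightarrow> bool" where
  "rank_feasible r p q n \<longleftrightarrow>
     (\<exists>c\<le>n. p \<le> r ^ c \<and> (\<exists>s\<in>compositions r (n - c). q \<le> prod_list s))"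

lemma rank_feasible_rank_le:
  assumes "rank_feasible r p q n"
  shows "r \<le> n"
  using assms compositions_length_le unfolding rank_feasible_def
  by (meson diff_le_self order_trans)

lemma rank_feasible_rank_ge_2:
  assumes "rank_feasible r p q n" "2 \<le> p"
  shows "2 \<le> r"
proof (rule ccontr)
  assume "\<not> 2 \<le> r"
  then have "r ^ c \<le> 1 ^ c" for c
    by (intro power_mono) auto
  also have "1 ^ c < p" for c
    using assms(2) by simp
  finally have "r ^ c < p" for c .
  with assms(1) show False
    unfolding rank_feasible_def by (meson leD)
qed

lemma ex_rank_feasible:
  assumes "2 \<le> r"
  shows "\<exists>n. rank_feasible r p q n"
proof -
  let ?s = "Suc q # replicate (r - 1) 1"
  have "?s \<in> compositions r (Suc q + (r - 1) + p - p)"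
    using Cons_replicate_1_in_compositions[of "Suc q" "r - 1"] assms by simp
  moreover have "q \<le> prod_list ?s"
    by simp
  moreover have "p \<le> r ^ p"
    using assms by (simp add: less_imp_le self_le_ge2_pow)
  ultimately show ?thesis
    unfolding rank_feasible_def by (meson le_add2)
qed

lemma nat_ceiling_log_le_iff:
  fixes b k n :: nat
  assumes "2 \<le> b" "1 \<le> k"
  shows "nat \<lceil>log (real b) (real k)\<rceil> \<le> n \<longleftrightarrow> k \<le> b ^ n"
proof
  assume "nat \<lceil>log b k\<rceil> \<le> n"
  then have "b ^ nat \<lceil>log b k\<rceil> \<le> b ^ n"
    using assms by (intro power_increasing) auto
  moreover have "real k \<le> real b ^ nat \<lceil>log b k\<rceil>"
    using assms by (intro power_of_nat_log_ge) simp
  then have "k \<le> b ^ nat \<lceil>log b k\<rceil>"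
    by (simp flip: of_nat_power)
  ultimately show "k \<le> b ^ n"
    by (rule order_trans[rotated])
next
  assume "k \<le> b ^ n"
  then have "log b k \<le> n"
    using assms by (intro log_of_power_le) auto
  then show "nat \<lceil>log b k\<rceil> \<le> n"
    by (simp add: nat_le_iff ceiling_le_iff)
qed

lemma rank_feasible_iff_least_exponent:
  assumes "1 \<le> r" and least: "\<And>d. c \<le> d \<longleftrightarrow> p \<le> r ^ d"
  shows "rank_feasible r p q n \<longleftrightarrow>
           c \<le> n \<and> (\<exists>s\<in>compositions r (n - c). q \<le> prod_list s)"
proof
  assume "rank_feasible r p q n"
  then obtain d s where d: "d \<le> n" "p \<le> r ^ d"
    and s: "s \<in> compositions r (n - d)" "q \<le> prod_list s"
    unfolding rank_feasible_def by blast
  have "c \<le> d"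
    using least d(2) by simp
  with d(1) have "c \<le> n"
    by simp
  obtain t where t: "t \<in> compositions r (n - c)" "prod_list s \<le> prod_list t"
    using s(1) \<open>1 \<le> r\<close> diff_le_mono2[OF \<open>c \<le> d\<close>] by (rule compositions_prod_list_mono)
  have "q \<le> prod_list t"
    using s(2) t(2) by (rule order_trans)
  with \<open>c \<le> n\<close> t(1)
  show "c \<le> n \<and> (\<exists>s\<in>compositions r (n - c). q \<le> prod_list s)"
    by blast
next
  have "p \<le> r ^ c"
    using least by blast
  then show "rank_feasible r p q n"
    if "c \<le> n \<and> (\<exists>s\<in>compositions r (n - c). q \<le> prod_list s)"
    using that unfolding rank_feasible_def by blast
qed

lemma rank_feasible_iff_max_comp_prod:
  assumes "2 \<le> r" "1 \<le> p"
  shows "rank_feasible r p q n \<longleftrightarrow>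
           int r \<le> int n - \<lceil>log (real r) (real p)\<rceil> \<and>
           q \<le> max_comp_prod r (nat (int n - \<lceil>log (real r) (real p)\<rceil>))"
proof -
  define c where "c = nat \<lceil>log (real r) (real p)\<rceil>"
  have "0 \<le> log (real r) (real p)"
    using assms by simp
  then have ceiling_log: "\<lceil>log (real r) (real p)\<rceil> = int c"
    by (simp add: c_def zero_le_ceiling)
  have "c \<le> d \<longleftrightarrow> p \<le> r ^ d" for d
    unfolding c_def using assms by (rule nat_ceiling_log_le_iff)
  then have "rank_feasible r p q n \<longleftrightarrow>
      c \<le> n \<and> (\<exists>s\<in>compositions r (n - c). q \<le> prod_list s)"
    using assms by (intro rank_feasible_iff_least_exponent) auto
  also have "\<dots> \<longleftrightarrow> c \<le> n \<and> r \<le> n - c \<and> q \<le> max_comp_prod r (n - c)"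
    using le_max_comp_prod_iff[of r "n - c" q] assms by simp
  also have "\<dots> \<longleftrightarrow> int r \<le> int n - int c \<and> q \<le> max_comp_prod r (nat (int n - int c))"
    using assms by (auto simp: nat_diff_distrib)
  finally show ?thesis
    by (simp only: ceiling_log)
qed

lemma Least_Least:
  fixes F :: "'i \<Rightarrow> 'n::wellorder \<Rightarrow> bool"
  assumes "I \<noteq> {}" and ex: "\<And>i. i \<in> I \<Longrightarrow> \<exists>n. F i n"
  shows "(LEAST m. \<exists>i\<in>I. m = (LEAST n. F i n)) = (LEAST n. \<exists>i\<in>I. F i n)"
proof -
  define N where "N = (LEAST n. \<exists>i\<in>I. F i n)"
  have "\<exists>i\<in>I. F i N"
    unfolding N_def by (rule LeastI_ex) (use assms in blast)
  then obtain i where "i \<in> I" "F i N"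
    by blast
  have N_le: "N \<le> (LEAST n. F k n)" if "k \<in> I" for k
    unfolding N_def using that LeastI_ex[OF ex] by (intro Least_le) blast
  have "N = (LEAST n. F i n)"
    using N_le[OF \<open>i \<in> I\<close>] Least_le[of "F i", OF \<open>F i N\<close>] by (rule antisym)
  then have "(LEAST m. \<exists>i\<in>I. m = (LEAST n. F i n)) = N"
    using N_le \<open>i \<in> I\<close> by (intro Least_equality) auto
  then show ?thesis
    by (simp add: N_def)
qed

lemma beta_eq_Least_rank_feasible:
  assumes "1 \<le> p"
  shows "beta p q = (LEAST n. \<exists>r\<ge>2. rank_feasible r p q n)"
proof -
  have "beta_r r p q = (LEAST n. rank_feasible r p q n)" if "2 \<le> r" for r
    unfolding beta_r_def using rank_feasible_iff_max_comp_prod[OF that assms] by simp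
  then have "beta p q = (LEAST b. \<exists>r\<in>{2..}. b = (LEAST n. rank_feasible r p q n))"
    unfolding beta_def by (metis atLeast_iff)
  also have "\<dots> = (LEAST n. \<exists>r\<in>{2..}. rank_feasible r p q n)"
    by (rule Least_Least) (auto intro: ex_rank_feasible)
  finally show ?thesis
    by (simp add: Bex_def)
qed


subsection \<open>Sections of a map\<close>

definition sections :: "('x \<Rightarrow> 'k) \<Rightarrow> 'x set \<Rightarrow> ('k \<Rightarrow> 'x) set" where
  "sections b X = (\<Pi>\<^sub>E k\<in>b ` X. {x \<in> X. b x = k})"

lemma sections_apply_in: "t \<in> sections b X \<Longrightarrow> k \<in> b ` X \<Longrightarrow> t k \<in> X"
  and sections_right_inverse: "t \<in> sections b X \<Longrightarrow> k \<in> b ` X \<Longrightarrow> b (t k) = k"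
  by (auto simp only: sections_def dest!: PiE_mem)

lemma finite_sections: "finite X \<Longrightarrow> finite (sections b X)"
  unfolding sections_def by (intro finite_PiE) auto

lemma card_sections:
  "finite X \<Longrightarrow> card (sections b X) = (\<Prod>k\<in>b ` X. card {x \<in> X. b x = k})"
  unfolding sections_def by (rule card_PiE) simp

lemma ex_composition_of_map:
  assumes "finite X"
  shows "\<exists>s\<in>compositions (card (b ` X)) (card X). prod_list s = card (sections b X)"
proof -
  let ?size = "\<lambda>k. card {x \<in> X. b x = k}"
  obtain ks where ks: "set ks = b ` X" "distinct ks"
    using finite_distinct_list[of "b ` X"] assms by blast
  have "1 \<le> ?size k" if "k \<in> b ` X" for k
    using that assms by (auto simp: Suc_le_eq card_gt_0_iff)
  moreover have "sum_list (map ?size ks) = card X"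
    using sum.image_gen[OF assms, of "\<lambda>_. 1::nat" b] ks
    by (simp add: sum_list_distinct_conv_sum_set)
  ultimately have "map ?size ks \<in> compositions (card (b ` X)) (card X)"
    using ks distinct_card[of ks] by (auto simp: compositions_def)
  moreover have "prod_list (map ?size ks) = card (sections b X)"
    using ks prod.distinct_set_conv_list[of ks ?size] assms by (simp add: card_sections)
  ultimately show ?thesis
    by blast
qed

lemma ex_map_of_composition:
  assumes "finite X" and s: "s \<in> compositions r (card X)"
  shows "\<exists>b :: 'x \<Rightarrow> nat. card (b ` X) = r \<and> card (sections b X) = prod_list s"
proof -
  let ?S = "SIGMA k:{..<r}. {..<s ! k}"
  have len: "length s = r" and pos: "\<And>k. k < r \<Longrightarrow> 0 < s ! k"
    using s by (auto simp: compositions_def Suc_le_eq)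
  have "card X = card ?S"
    using s by (auto simp: compositions_def sum_list_sum_nth atLeast0LessThan)
  then obtain f where f: "bij_betw f X ?S"
    using finite_same_card_bij[OF \<open>finite X\<close>, of ?S] by auto
  define b where "b = fst \<circ> f"
  have "b ` X = fst ` ?S"
    by (simp add: b_def image_image flip: bij_betw_imp_surj_on[OF f])
  also have "\<dots> = {..<r}"
    using pos by force
  finally have image: "b ` X = {..<r}" .
  have "card {x \<in> X. b x = k} = s ! k" if "k < r" for k
  proof -
    have "bij_betw f {x \<in> X. b x = k} {y \<in> ?S. fst y = k}"
      by (rule bij_betw_Collect[OF f]) (simp add: b_def)
    moreover have "{y \<in> ?S. fst y = k} = {k} \<times> {..<s ! k}"
      using that by auto
    ultimately show ?thesis
      by (simp add: bij_betw_same_card)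
  qed
  then have "card (sections b X) = (\<Prod>k<r. s ! k)"
    using \<open>finite X\<close> by (simp add: card_sections image)
  also have "\<dots> = prod_list s"
    by (simp add: prod.list_conv_set_nth len atLeast0LessThan)
  finally show ?thesis
    using image by (intro exI[of _ b]) simp
qed


subsection \<open>Rectangular bands of transformations\<close>

locale rect_band_embedding =
  fixes P :: "'a set" and Q :: "'b set" and \<Omega> :: "'x set" and h :: "'a \<times> 'b \<Rightarrow> 'x \<Rightarrow> 'x"
  assumes embedding:
    "semigroup_embedding (P \<times> Q) rect_mult (\<Omega> \<rightarrow>\<^sub>E \<Omega>) (\<lambda>f g. compose \<Omega> g f) h"

lemma rect_band_embedding_full_trans_iff:
  "rect_band_embedding P Q {1..n} h \<longleftrightarrow>
     semigroup_embedding (P \<times> Q) rect_mult (full_trans n) (trans_mult n) h"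
  by (simp add: rect_band_embedding_def full_trans_def trans_mult_def[abs_def])

lemma rect_band_embedding_comp_map_prod:
  assumes "rect_band_embedding U T \<Omega> h"
    and "f ` P \<subseteq> U" "inj_on f P" and "g ` Q \<subseteq> T" "inj_on g Q"
  shows "rect_band_embedding P Q \<Omega> (h \<circ> map_prod f g)"
  unfolding rect_band_embedding_def semigroup_embedding_def
proof (intro conjI)
  have h: "h \<in> U \<times> T \<rightarrow> (\<Omega> \<rightarrow>\<^sub>E \<Omega>)" "inj_on h (U \<times> T)"
    "\<And>x y. x \<in> U \<times> T \<Longrightarrow> y \<in> U \<times> T \<Longrightarrow> h (rect_mult x y) = compose \<Omega> (h y) (h x)"
    using assms(1) unfolding rect_band_embedding_def semigroup_embedding_def by blast+
  have into: "map_prod f g ` (P \<times> Q) \<subseteq> U \<times> T"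
    using assms by auto
  show "h \<circ> map_prod f g \<in> P \<times> Q \<rightarrow> (\<Omega> \<rightarrow>\<^sub>E \<Omega>)"
    using h(1) into by fastforce
  show "inj_on (h \<circ> map_prod f g) (P \<times> Q)"
    using assms h(2) into by (intro comp_inj_on map_prod_inj_on) (auto intro: inj_on_subset)
  show "\<forall>x\<in>P \<times> Q. \<forall>y\<in>P \<times> Q. (h \<circ> map_prod f g) (rect_mult x y) =
          compose \<Omega> ((h \<circ> map_prod f g) y) ((h \<circ> map_prod f g) x)"
  proof (intro ballI)
    fix x y assume "x \<in> P \<times> Q" "y \<in> P \<times> Q"
    then have "map_prod f g x \<in> U \<times> T" "map_prod f g y \<in> U \<times> T"
      using into by blast+
    moreover have "map_prod f g (rect_mult x y) = rect_mult (map_prod f g x) (map_prod f g y)"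
      by (simp add: rect_mult_def)
    ultimately show "(h \<circ> map_prod f g) (rect_mult x y) =
        compose \<Omega> ((h \<circ> map_prod f g) y) ((h \<circ> map_prod f g) x)"
      by (simp only: comp_apply h(3))
  qed
qed

text \<open>The attachment \<open>u\<close> determines the kernel, the section \<open>t\<close> the image.\<close>

definition attach_then_choose ::
  "('x \<Rightarrow> 'k) \<Rightarrow> 'x set \<Rightarrow> 'x set \<Rightarrow> ('x \<Rightarrow> 'k) \<times> ('k \<Rightarrow> 'x) \<Rightarrow> 'x \<Rightarrow> 'x" where
  "attach_then_choose b X \<Omega> = (\<lambda>(u, t). \<lambda>x\<in>\<Omega>. t (override_on u b X x))"

lemma rect_band_embedding_attach_then_choose:
  assumes "X \<subseteq> \<Omega>"
  shows "rect_band_embedding ((\<Omega> - X) \<rightarrow>\<^sub>E b ` X) (sections b X) \<Omega> (attach_then_choose b X \<Omega>)"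
    (is "rect_band_embedding ?U ?T \<Omega> ?h")
  unfolding rect_band_embedding_def semigroup_embedding_def
proof (intro conjI)
  have class_in: "override_on u b X x \<in> b ` X" if "u \<in> ?U" "x \<in> \<Omega>" for u x
    using that by (cases "x \<in> X") (auto dest: PiE_mem)
  note choice_in = sections_apply_in[OF _ class_in]
  note choice_class = sections_right_inverse[OF _ class_in]
  show "?h \<in> ?U \<times> ?T \<rightarrow> (\<Omega> \<rightarrow>\<^sub>E \<Omega>)"
    using choice_in assms unfolding attach_then_choose_def by fastforce
  show "inj_on ?h (?U \<times> ?T)"
  proof (rule inj_onI, clarify)
    fix u t u' t'
    assume ut: "u \<in> ?U" "t \<in> ?T" and ut': "u' \<in> ?U" "t' \<in> ?T" and "?h (u, t) = ?h (u', t')"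
    then have eq: "t (override_on u b X x) = t' (override_on u' b X x)" if "x \<in> \<Omega>" for x
      using that by (auto simp: attach_then_choose_def dest: fun_cong[of _ _ x])
    have "t (b x) = t' (b x)" if "x \<in> X" for x
      using eq[of x] that assms by auto
    then have "t = t'"
      using ut(2) ut'(2) unfolding sections_def by (intro PiE_ext) auto
    moreover have "u x = u' x" if "x \<in> \<Omega> - X" for x
      using eq[of x] choice_class[OF ut(2,1), of x] choice_class[OF ut'(2,1), of x] that by simp
    then have "u = u'"
      using ut(1) ut'(1) by (intro PiE_ext) auto
    ultimately show "u = u' \<and> t = t'"
      by simp
  qed
  show "\<forall>y\<in>?U \<times> ?T. \<forall>z\<in>?U \<times> ?T. ?h (rect_mult y z) = compose \<Omega> (?h z) (?h y)"
  proof (intro ballI ext)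
    fix y z x assume "y \<in> ?U \<times> ?T" "z \<in> ?U \<times> ?T"
    then obtain u t u' t' where "y = (u, t)" "z = (u', t')" and ut: "u \<in> ?U" "t \<in> ?T"
      by blast
    then show "?h (rect_mult y z) x = compose \<Omega> (?h z) (?h y) x"
      using choice_in[OF ut(2,1), of x] choice_class[OF ut(2,1), of x] assms
      by (auto simp: attach_then_choose_def compose_def rect_mult_def)
  qed
qed

context rect_band_embedding
begin

lemma maps: "i \<in> P \<Longrightarrow> j \<in> Q \<Longrightarrow> h (i, j) \<in> \<Omega> \<rightarrow>\<^sub>E \<Omega>"
  using embedding by (auto simp: semigroup_embedding_def)

lemma apply_in: "i \<in> P \<Longrightarrow> j \<in> Q \<Longrightarrow> x \<in> \<Omega> \<Longrightarrow> h (i, j) x \<in> \<Omega>"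
  using maps by (rule PiE_mem)

lemma apply_apply:
  assumes "i \<in> P" "j \<in> Q" "k \<in> P" "l \<in> Q" "x \<in> \<Omega>"
  shows "h (k, l) (h (i, j) x) = h (i, l) x"
proof -
  have "h (rect_mult (i, j) (k, l)) = compose \<Omega> (h (k, l)) (h (i, j))"
    using embedding assms unfolding semigroup_embedding_def by blast
  with assms(5) show ?thesis
    by (simp add: rect_mult_def compose_def)
qed

lemma eq_if_apply_eq:
  assumes "i \<in> P" "j \<in> Q" "k \<in> P" "l \<in> Q" and "\<And>x. x \<in> \<Omega> \<Longrightarrow> h (i, j) x = h (k, l) x"
  shows "i = k \<and> j = l"
proof -
  have "h (i, j) = h (k, l)"
    using assms by (intro PiE_ext[OF maps maps])
  moreover have "inj_on h (P \<times> Q)"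
    using embedding by (simp add: semigroup_embedding_def)
  ultimately show ?thesis
    using assms by (auto dest: inj_onD)
qed

definition image_union :: "'x set" where
  "image_union = (\<Union>z\<in>P \<times> Q. h z ` \<Omega>)"

lemma image_union_subset: "image_union \<subseteq> \<Omega>"
  using apply_in by (auto simp: image_union_def)

lemma apply_in_image_union:
  "i \<in> P \<Longrightarrow> j \<in> Q \<Longrightarrow> x \<in> \<Omega> \<Longrightarrow> h (i, j) x \<in> image_union"
  by (auto simp: image_union_def)

lemma apply_eq_on_image_union:
  assumes "i \<in> P" "k \<in> P" "j \<in> Q" "x \<in> image_union"
  shows "h (i, j) x = h (k, j) x"
  using assms apply_apply by (auto simp: image_union_def)

lemma image_image_union:
  assumes "i \<in> P" "j \<in> Q"
  shows "h (i, j) ` image_union = h (i, j) ` \<Omega>"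
proof
  show "h (i, j) ` image_union \<subseteq> h (i, j) ` \<Omega>"
    by (intro image_mono image_union_subset)
  show "h (i, j) ` \<Omega> \<subseteq> h (i, j) ` image_union"
  proof
    fix y assume "y \<in> h (i, j) ` \<Omega>"
    then obtain x where "x \<in> \<Omega>" "y = h (i, j) (h (i, j) x)"
      using apply_apply assms by auto
    then show "y \<in> h (i, j) ` image_union"
      using apply_in_image_union assms by blast
  qed
qed

lemma card_right_le_card_sections:
  assumes "finite \<Omega>" and i: "i \<in> P" and j: "j \<in> Q"
  shows "card Q \<le> card (sections (h (i, j)) image_union)"
proof (rule card_inj_on_le)
  let ?A = "h (i, j) ` image_union" and ?t = "\<lambda>l. restrict (h (i, l)) (h (i, j) ` image_union)"
  have A: "?A = h (i, j) ` \<Omega>"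
    using image_image_union i j .
  show "?t ` Q \<subseteq> sections (h (i, j)) image_union"
    unfolding sections_def using A apply_apply apply_in apply_in_image_union i j by auto
  show "inj_on ?t Q"
  proof (rule inj_onI)
    fix l l' assume l: "l \<in> Q" "l' \<in> Q" and "?t l = ?t l'"
    then have "h (i, l) (h (i, j) x) = h (i, l') (h (i, j) x)" if "x \<in> \<Omega>" for x
      using that A by (metis imageI restrict_apply')
    then have "h (i, l) x = h (i, l') x" if "x \<in> \<Omega>" for x
      using that apply_apply i j l by simp
    then show "l = l'"
      using eq_if_apply_eq i l by blast
  qed
  show "finite (sections (h (i, j)) image_union)"
    using \<open>finite \<Omega>\<close> image_union_subset finite_subset by (intro finite_sections) blast
qed

lemma card_left_le_rank_power:
  assumes "finite \<Omega>" and i: "i \<in> P" and j: "j \<in> Q"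
  shows "card P \<le> card (h (i, j) ` image_union) ^ card (\<Omega> - image_union)"
proof -
  let ?A = "h (i, j) ` image_union" and ?C = "\<Omega> - image_union"
  let ?u = "\<lambda>k. restrict (h (k, j)) (\<Omega> - image_union)"
  have "card P \<le> card (?C \<rightarrow>\<^sub>E ?A)"
  proof (rule card_inj_on_le)
    have "h (k, j) x = h (i, j) (h (k, j) x)" if "k \<in> P" "x \<in> \<Omega>" for k x
      using apply_apply that i j by simp
    then have "h (k, j) x \<in> ?A" if "k \<in> P" "x \<in> \<Omega>" for k x
      using that apply_in_image_union j by (metis imageI)
    then show "?u ` P \<subseteq> ?C \<rightarrow>\<^sub>E ?A"
      by (intro image_subsetI restrict_PiE_iff[THEN iffD2] ballI) simp
    show "inj_on ?u P"
    proof (rule inj_onI)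
      fix k k' assume k: "k \<in> P" "k' \<in> P" and "?u k = ?u k'"
      then have "h (k, j) x = h (k', j) x" if "x \<in> ?C" for x
        using that by (metis restrict_apply')
      then have "h (k, j) x = h (k', j) x" if "x \<in> \<Omega>" for x
        using that apply_eq_on_image_union k j by blast
      then show "k = k'"
        using eq_if_apply_eq k j by blast
    qed
    have "finite ?A"
      using \<open>finite \<Omega>\<close> image_union_subset finite_subset by blast
    then show "finite (?C \<rightarrow>\<^sub>E ?A)"
      using \<open>finite \<Omega>\<close> by (intro finite_PiE) auto
  qed
  also have "\<dots> = card ?A ^ card ?C"
    using \<open>finite \<Omega>\<close> by (simp add: card_funcsetE)
  finally show ?thesis .
qed

lemma ex_rank_feasible_card:
  assumes "finite \<Omega>" "P \<noteq> {}" "Q \<noteq> {}"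
  shows "\<exists>r. rank_feasible r (card P) (card Q) (card \<Omega>)"
proof -
  obtain i j where ij: "i \<in> P" "j \<in> Q"
    using assms by blast
  define r where "r = card (h (i, j) ` image_union)"
  define c where "c = card (\<Omega> - image_union)"
  have "finite image_union"
    using image_union_subset \<open>finite \<Omega>\<close> by (rule finite_subset)
  then obtain s where s: "s \<in> compositions r (card image_union)"
    "prod_list s = card (sections (h (i, j)) image_union)"
    unfolding r_def using ex_composition_of_map by blast
  have "card \<Omega> = c + card image_union"
    unfolding c_def using \<open>finite \<Omega>\<close> image_union_subset
    by (simp add: card_Diff_subset card_mono finite_subset)
  then have "c \<le> card \<Omega>" "s \<in> compositions r (card \<Omega> - c)"
    using s(1) by simp_all
  moreover have "card Q \<le> prod_list s"
    using card_right_le_card_sections[OF \<open>finite \<Omega>\<close> ij] s(2) by simp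
  moreover have "card P \<le> r ^ c"
    unfolding r_def c_def using card_left_le_rank_power[OF \<open>finite \<Omega>\<close> ij] .
  ultimately show ?thesis
    unfolding rank_feasible_def by blast
qed

end

lemma ex_rect_band_embedding_if_rank_feasible:
  assumes "finite P" "finite Q" "finite \<Omega>" and "rank_feasible r (card P) (card Q) (card \<Omega>)"
  shows "\<exists>h. rect_band_embedding P Q \<Omega> h"
proof -
  obtain c s where c: "c \<le> card \<Omega>" "card P \<le> r ^ c"
    and s: "s \<in> compositions r (card \<Omega> - c)" "card Q \<le> prod_list s"
    using assms(4) unfolding rank_feasible_def by blast
  obtain X where X: "X \<subseteq> \<Omega>" "card X = card \<Omega> - c"
    using obtain_subset_with_card_n[of "card \<Omega> - c" \<Omega>] by auto
  have "finite X"
    using X(1) \<open>finite \<Omega>\<close> by (rule finite_subset)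
  then obtain b :: "_ \<Rightarrow> nat" where b: "card (b ` X) = r" "card (sections b X) = prod_list s"
    using ex_map_of_composition[of X s r] s X by auto
  have "card (\<Omega> - X) = c"
    using X c(1) \<open>finite X\<close> by (simp add: card_Diff_subset)
  then have "card P \<le> card ((\<Omega> - X) \<rightarrow>\<^sub>E b ` X)"
    using c(2) b(1) \<open>finite \<Omega>\<close> by (simp add: card_funcsetE)
  then obtain f where "f ` P \<subseteq> (\<Omega> - X) \<rightarrow>\<^sub>E b ` X" "inj_on f P"
    using card_le_inj[OF \<open>finite P\<close>] \<open>finite X\<close> \<open>finite \<Omega>\<close>
    by (metis finite_Diff finite_PiE finite_imageI)
  moreover obtain g where "g ` Q \<subseteq> sections b X" "inj_on g Q"
    using card_le_inj[OF \<open>finite Q\<close> finite_sections[OF \<open>finite X\<close>], of b] b(2) s(2) by auto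
  ultimately show ?thesis
    using rect_band_embedding_attach_then_choose[OF X(1)]
    by (intro exI[of _ "attach_then_choose b X \<Omega> \<circ> map_prod f g"]
        rect_band_embedding_comp_map_prod)
qed

theorem ex_rect_band_embedding_iff_rank_feasible:
  assumes "finite P" "P \<noteq> {}" "finite Q" "Q \<noteq> {}" "finite \<Omega>"
  shows "(\<exists>h. rect_band_embedding P Q \<Omega> h) \<longleftrightarrow>
           (\<exists>r. rank_feasible r (card P) (card Q) (card \<Omega>))"
proof
  show "\<exists>r. rank_feasible r (card P) (card Q) (card \<Omega>)"
    if "\<exists>h. rect_band_embedding P Q \<Omega> h"
    using that rect_band_embedding.ex_rank_feasible_card assms by blast
  show "\<exists>h. rect_band_embedding P Q \<Omega> h"
    if "\<exists>r. rank_feasible r (card P) (card Q) (card \<Omega>)"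
    using that ex_rect_band_embedding_if_rank_feasible assms by blast
qed

theorem theorem3p9:
  fixes p q :: nat and P :: "'a set" and Q :: "'b set"
  assumes "p \<ge> 2" and "q \<ge> 2"
    and "finite P" and "card P = p"
    and "finite Q" and "card Q = q"
  shows "semigroup_degree (P \<times> Q) rect_mult = beta p q"
proof -
  have "P \<noteq> {}" "Q \<noteq> {}"
    using assms by auto
  then have "(\<exists>h. semigroup_embedding (P \<times> Q) rect_mult (full_trans n) (trans_mult n) h)
               \<longleftrightarrow> (\<exists>r. rank_feasible r p q n)" for n
    using ex_rect_band_embedding_iff_rank_feasible[of P Q "{1..n}"] assms
    unfolding rect_band_embedding_full_trans_iff by simp
  then have "1 \<le> n \<and> (\<exists>h. semigroup_embedding (P \<times> Q) rect_mult (full_trans n) (trans_mult n) h)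
               \<longleftrightarrow> (\<exists>r\<ge>2. rank_feasible r p q n)" for n
    using rank_feasible_rank_ge_2[OF _ \<open>p \<ge> 2\<close>] rank_feasible_rank_le
    by (metis one_le_numeral order_trans)
  then show ?thesis
    using beta_eq_Least_rank_feasible[of p q] \<open>p \<ge> 2\<close> by (simp add: semigroup_degree_def)
qed

end
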